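(* Let $k\ge 4$ be an integer. Then $F_k(n) = \frac{n}{2}+2$ for every integer $n$ with $n>2k$ and $n\equiv 4 \pmod{12}$.
   Context: A star is a complete bipartite graph $K_{1,t}$. For an integer $k\ge 1$, a $k$-star-forest is a forest with at most $k$ connected components where each component is a star. A decomposition of a graph $G$ is a family of subgraphs of $G$ whose edge sets partition $E(G)$. $K_n$ denotes the complete graph on $n$ vertices. $F_k(n)$ denotes the minimum integer such that $K_n$ can be decomposed into $F_k(n)$ $k$-star-forests. *)

theory Defs
  imports
    "Graph_Theory.Graph_Theory"
    "HOL-Library.Disjoint_Sets"
    "HOL-Number_Theory.Cong"
begin

text \<open>
  Simple undirected graphs are represented as in the entry Graph_Theory: the locale predicate
  \<^const>\<open>graph\<close> describes finite symmetric digraphs without loops and parallel arcs, an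
  edge uv being the pair of arcs (u,v), (v,u). The connected components of such a graph are its
  strongly connected components.
\<close>

definition star :: "('a, 'b) pre_digraph \<Rightarrow> bool" where
  "star G \<longleftrightarrow> (\<exists>t. complete_bipartite_digraph 1 t G)"

text \<open>
  The library's \<^const>\<open>forest\<close> forbids every directed cycle, including the 2-cycle formed
  by the two arcs of a single edge. The cycles of the underlying undirected graph are the directed
  cycles of length at least 3.
\<close>

definition undirected_forest :: "('a, 'b) pre_digraph \<Rightarrow> bool" where
  "undirected_forest G \<longleftrightarrow> graph G \<and> \<not> (\<exists>p. pre_digraph.cycle G p \<and> 3 \<le> length p)"

definition star_forest :: "nat \<Rightarrow> ('a, 'b) pre_digraph \<Rightarrow> bool" where
  "star_forest k G \<longleftrightarrow> undirected_forest G \<and>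
     card (pre_digraph.sccs G) \<le> k \<and> (\<forall>C \<in> pre_digraph.sccs G. star C)"

text \<open>
  Since all the graphs involved are symmetric, their arc sets partition the arc set of \<open>G\<close>
  iff their edge sets partition the edge set of \<open>G\<close>. Members need not be spanning, and
  members without edges are allowed; they play no role for the minimum below.
\<close>

definition decomposition ::
    "('a, 'b) pre_digraph \<Rightarrow> 'i set \<Rightarrow> ('i \<Rightarrow> ('a, 'b) pre_digraph) \<Rightarrow> bool" where
  "decomposition G I H \<longleftrightarrow> (\<forall>i \<in> I. graph (H i) \<and> subgraph (H i) G) \<and>
     disjoint_family_on (\<lambda>i. arcs (H i)) I \<and> (\<Union>i \<in> I. arcs (H i)) = arcs G"

definition complete_graph :: "nat \<Rightarrow> (nat, nat \<times> nat) pre_digraph" where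
  "complete_graph n =
     with_proj \<lparr>pverts = {..<n}, parcs = {(u, v). u < n \<and> v < n \<and> u \<noteq> v}\<rparr>"

lemma complete_digraph_complete_graph: "complete_digraph n (complete_graph n)"
  unfolding complete_graph_def complete_digraph_pair_def by auto

text \<open>
  For \<open>k \<ge> 1\<close> the minimum exists: the single edges form a decomposition into 1-star-forests.
\<close>

definition F :: "nat \<Rightarrow> nat \<Rightarrow> nat" where
  "F k n = (LEAST m. \<exists>H. decomposition (complete_graph n) {..<m} H \<and>
     (\<forall>i < m. star_forest k (H i)))"

end

theory Submission
  imports Defs
begin

text \<open>
  The residue of \<open>n\<close> enters through its parity (\<open>F_eq_of_even\<close>).

  A star forest is determined by its set \<open>C\<close> of centres together with the centre chosen by each
  leaf. If every vertex outside \<open>C\<close> is allowed to choose one vertex of \<open>C\<close>, the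
  problem becomes one of covering all pairs of vertices by such choices: a pair covered several
  times can be kept in the first forest that covers it, because deleting edges from a star forest
  leaves a star forest with the same centres. Hence decompositions of \<open>K\<^sub>n\<close> into \<open>m\<close>
  \<open>k\<close>-star-forests and covers by \<open>m\<close> choices with at most \<open>k\<close> centres each are
  interchangeable (\<open>star_cover_imp_decomposition\<close>, \<open>decomposition_imp_star_cover\<close>).

  \<^bold>\<open>Lower bound\<close> (\<open>star_cover_many_centres\<close>). Let \<open>n = 2h\<close> and suppose that
  \<open>h + 1\<close> forests suffice. There are only few more (forest, non-centre) pairs than edges,
  so on average a vertex is a centre at most \<open>3/2\<close> times. Therefore at least half of the
  vertices are centres exactly once, and no two of these in the same forest. A vertex that is a
  centre exactly twice cannot be so in the two forests belonging to two such vertices: the three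
  edges of the resulting triangle would have to be covered by only two choices. Counting now forces
  one forest in which \<open>h\<close> vertices are centres, which is impossible if \<open>k < h\<close>.

  \<^bold>\<open>Upper bound\<close> (\<open>strip_star_cover\<close>). Let every vertex be a centre in exactly two of
  the \<open>h + 2\<close> forests. The vertices then become the edges of a graph whose nodes are the
  forests, and at most four centres per forest means maximum degree at most \<open>4\<close>. The choices
  made inside a set of \<open>s\<close> nodes can cover all pairs of the edges that it spans only if there
  are at most \<open>2s - 3\<close> of these. The square of a path, a strip of triangles, attains this
  bound on every interval and has maximum degree \<open>4\<close>; the tightness leaves almost no freedom,
  and each choice can be written down explicitly.
\<close>

section \<open>Covers by choices of centres\<close>

definition joins :: "'a set \<Rightarrow> ('a \<Rightarrow> 'a) \<Rightarrow> 'a \<Rightarrow> 'a \<Rightarrow> bool" where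
  "joins C p u v \<longleftrightarrow> (u \<notin> C \<and> v \<in> C \<and> p u = v) \<or> (v \<notin> C \<and> u \<in> C \<and> p v = u)"

definition star_cover :: "'a set \<Rightarrow> nat \<Rightarrow> (nat \<Rightarrow> 'a set) \<Rightarrow> (nat \<Rightarrow> 'a \<Rightarrow> 'a) \<Rightarrow> bool" where
  "star_cover V m C p \<longleftrightarrow> (\<forall>f<m. C f \<subseteq> V) \<and>
     (\<forall>u\<in>V. \<forall>v\<in>V. u \<noteq> v \<longrightarrow> (\<exists>f<m. joins (C f) (p f) u v))"

lemma joins_sym: "joins C p u v \<longleftrightarrow> joins C p v u"
  unfolding joins_def by auto

section \<open>A lower bound for star covers\<close>

text \<open>
  Each pair of vertices uses up one choice, that is, a forest together with a vertex that is not a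
  centre there.
\<close>
lemma star_cover_slots:
  assumes cov: "star_cover V m C p" and fin: "finite V"
  shows "(card V choose 2) + (\<Sum>f<m. card (C f)) \<le> m * card V"
proof -
  let ?S = "SIGMA f:{..<m}. V - C f"
  have CV: "f < m \<Longrightarrow> C f \<subseteq> V" for f using cov unfolding star_cover_def by blast
  have "{e. e \<subseteq> V \<and> card e = 2} \<subseteq> (\<lambda>(f, u). {u, p f u}) ` ?S"
  proof
    fix e assume "e \<in> {e. e \<subseteq> V \<and> card e = 2}"
    then obtain u v where e: "e = {u, v}" "u \<noteq> v" "u \<in> V" "v \<in> V"
      by (auto simp: card_2_iff)
    then obtain f where f: "f < m" "joins (C f) (p f) u v"
      using cov unfolding star_cover_def by blast
    from f(2) show "e \<in> (\<lambda>(f, u). {u, p f u}) ` ?S"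
      unfolding joins_def
    proof (elim disjE conjE)
      assume "u \<notin> C f" "p f u = v"
      then show ?thesis using e f(1) by (intro image_eqI[of _ _ "(f, u)"]) auto
    next
      assume "v \<notin> C f" "p f v = u"
      then show ?thesis using e f(1) by (intro image_eqI[of _ _ "(f, v)"]) auto
    qed
  qed
  then have "card {e. e \<subseteq> V \<and> card e = 2} \<le> card ?S"
    using fin by (intro surj_card_le) auto
  also have "card ?S = (\<Sum>f<m. card (V - C f))"
    using fin by simp
  finally have "card V choose 2 \<le> (\<Sum>f<m. card (V - C f))"
    by (simp add: n_subsets[OF fin])
  moreover have "(\<Sum>f<m. card (V - C f)) + (\<Sum>f<m. card (C f)) = (\<Sum>f<m. card V)"
    unfolding sum.distrib[symmetric]
  proof (rule sum.cong)
    fix f assume "f \<in> {..<m}"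
    then have "C f \<subseteq> V" using CV by simp
    then show "card (V - C f) + card (C f) = card V"
      using fin by (metis card_Diff_subset card_mono finite_subset le_add_diff_inverse2)
  qed simp
  ultimately show ?thesis by simp
qed

text \<open>
  Below, \<open>A v\<close> is the set of forests in which \<open>v\<close> is a centre, \<open>T\<close> consists of the
  vertices that are centres only once, and \<open>r t\<close> is the forest belonging to \<open>t \<in> T\<close>. The
  hypothesis \<open>3 \<le> h\<close> excludes a vertex that is never a centre: such a vertex has to make a
  choice for each of its \<open>2h - 1\<close> edges, but there are only \<open>h + 1\<close> forests.
\<close>
lemma star_cover_many_centres:
  assumes cov: "star_cover V (Suc h) C p"
    and cardV: "card V = 2 * h" and h: "3 \<le> h"
  shows "\<exists>f<Suc h. h \<le> card (C f)"
proof -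
  have fin: "finite V" using cardV h by (metis card.infinite mult_is_0 not_numeral_le_zero zero_neq_numeral)
  have CV: "f < Suc h \<Longrightarrow> C f \<subseteq> V" for f using cov unfolding star_cover_def by blast
  have cover: "\<exists>f<Suc h. joins (C f) (p f) u v" if "u \<in> V" "v \<in> V" "u \<noteq> v" for u v
    using cov that unfolding star_cover_def by blast
  define A where "A v = {f. f < Suc h \<and> v \<in> C f}" for v
  have finA [simp]: "finite (A v)" for v unfolding A_def by simp
  have sumA: "(\<Sum>v\<in>V. card (A v)) \<le> 3 * h"
  proof -
    have "(\<Sum>v\<in>V. card (A v)) = (\<Sum>f<Suc h. card {v \<in> V. v \<in> C f})"
      unfolding A_def
      using sum_multicount_gen[OF fin, of "{..<Suc h}" "\<lambda>v f. v \<in> C f" "\<lambda>f. card {v \<in> V. v \<in> C f}"]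
      by (simp add: conj_commute lessThan_def)
    also have "\<dots> = (\<Sum>f<Suc h. card (C f))"
    proof (rule sum.cong)
      fix f assume "f \<in> {..<Suc h}"
      then have "{v \<in> V. v \<in> C f} = C f" using CV by auto
      then show "card {v \<in> V. v \<in> C f} = card (C f)" by simp
    qed simp
    finally have "((2 * h) choose 2) + (\<Sum>v\<in>V. card (A v)) \<le> Suc h * (2 * h)"
      using star_cover_slots[OF cov fin] cardV by simp
    moreover have "((2 * h) choose 2) + h = 2 * h * h"
    proof -
      have "(2 * h) choose 2 = h * (2 * h - 1)" by (simp add: choose_two)
      moreover have "h * (2 * h - 1) + h = h * (2 * h)" using h by (cases h) (auto simp: algebra_simps)
      ultimately show ?thesis by simp
    qed
    ultimately show ?thesis by simp
  qed
  have A_pos: "1 \<le> card (A v)" if v: "v \<in> V" for v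
  proof (rule ccontr)
    assume "\<not> 1 \<le> card (A v)"
    then have "card (A v) = 0" by linarith
    then have "A v = {}" by simp
    then have vC: "v \<notin> C f" if "f < Suc h" for f using that unfolding A_def by auto
    have "V - {v} \<subseteq> (\<lambda>f. p f v) ` {..<Suc h}"
    proof
      fix w assume "w \<in> V - {v}"
      then obtain f where "f < Suc h" "joins (C f) (p f) v w" using cover[of v w] v by auto
      then show "w \<in> (\<lambda>f. p f v) ` {..<Suc h}" using vC unfolding joins_def by auto
    qed
    then have "card (V - {v}) \<le> Suc h" using surj_card_le[of "{..<Suc h}"] by auto
    then show False using cardV v fin h by simp
  qed
  define T where "T = {v \<in> V. card (A v) = 1}"
  have TV: "T \<subseteq> V" "finite T" using fin unfolding T_def by auto
  define r where "r v = the_elem (A v)" for v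
  have Ar: "A t = {r t}" if t: "t \<in> T" for t
  proof -
    obtain f where "A t = {f}" using t card_1_singletonE[of "A t"] unfolding T_def by blast
    then show ?thesis unfolding r_def by simp
  qed
  have r_less: "r ` T \<subseteq> {..<Suc h}" using Ar unfolding A_def by auto
  have distinct_A: "A u \<noteq> A v" if uv: "u \<in> V" "v \<in> V" "u \<noteq> v" for u v
  proof
    assume eq: "A u = A v"
    obtain f where "f < Suc h" "joins (C f) (p f) u v" using cover[OF uv] by auto
    then show False using eq unfolding joins_def A_def by blast
  qed
  have r_inj: "inj_on r T"
    by (rule inj_onI) (metis Ar TV(1) distinct_A subsetD)
  \<comment> \<open>The edges from u to t and t' must use the choice of t in r t' and that of t' in r t. No choice
    is left for the edge between t and t'.\<close>
  have no_triangle: "\<not> A u = {r t, r t'}"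
    if u: "u \<in> V" and t: "t \<in> T" "t' \<in> T" and ne: "u \<notin> T" for u t t'
  proof
    assume Au: "A u = {r t, r t'}"
    have tt: "r t \<noteq> r t'" using Au u ne unfolding T_def by auto
    have only: "joins (C f) (p f) x y \<Longrightarrow> f < Suc h \<Longrightarrow>
      (f \<in> A y \<and> f \<notin> A x \<and> p f x = y) \<or> (f \<in> A x \<and> f \<notin> A y \<and> p f y = x)" for f x y
      unfolding joins_def A_def by auto
    have "p (r t') t = u"
      using cover[of t u] only[of _ t u] Ar[OF t(1)] Au u t ne TV by auto
    moreover have "p (r t) t' = u"
      using cover[of t' u] only[of _ t' u] Ar[OF t(2)] Au u t ne TV by auto
    moreover have "p (r t') t = t' \<or> p (r t) t' = t"
      using cover[of t t'] only[of _ t t'] Ar t TV tt by auto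
    ultimately show False using t ne by auto
  qed
  let ?U = "V - T"
  have cardU: "card ?U = 2 * h - card T" using TV cardV by (simp add: card_Diff_subset)
  have sum_split: "card T + (\<Sum>u\<in>?U. card (A u)) \<le> 3 * h"
  proof -
    have "(\<Sum>v\<in>V. card (A v)) = (\<Sum>v\<in>T. card (A v)) + (\<Sum>u\<in>?U. card (A u))"
      using sum.subset_diff[OF TV(1) fin] by (simp add: add.commute)
    also have "(\<Sum>v\<in>T. card (A v)) = card T" unfolding T_def by simp
    finally show ?thesis using sumA by simp
  qed
  have two: "2 \<le> card (A u)" if "u \<in> ?U" for u
    using A_pos[of u] that unfolding T_def by force
  have cardT_le: "card T \<le> Suc h"
    using card_mono[OF _ r_less] card_image[OF r_inj] by simp
  have "card ?U * 2 \<le> (\<Sum>u\<in>?U. card (A u))"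
    using sum_bounded_below[of ?U 2 "\<lambda>u. card (A u)"] two by simp
  then have cardT_ge: "h \<le> card T" using sum_split cardU cardT_le h by linarith
  have rT_miss: "\<exists>f\<in>A u. f \<notin> r ` T" if u: "u \<in> ?U" and a: "card (A u) = 2" for u
  proof (rule ccontr)
    assume "\<not> ?thesis"
    then have "A u \<subseteq> r ` T" by auto
    moreover obtain f g where "A u = {f, g}" using a by (auto simp: card_2_iff)
    ultimately show False using no_triangle u by auto
  qed
  \<comment> \<open>If every forest belonged to a vertex of T, the other vertices would all be centres at least
    three times, which exceeds the total.\<close>
  have "card T = h"
  proof (rule ccontr)
    assume "card T \<noteq> h"
    then have cT: "card T = Suc h" using cardT_ge cardT_le by simp
    then have "r ` T = {..<Suc h}"
      using card_subset_eq[OF _ r_less] card_image[OF r_inj] by simp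
    then have "3 \<le> card (A u)" if "u \<in> ?U" for u
      using rT_miss[OF that] two[OF that] unfolding A_def by force
    then have "card ?U * 3 \<le> (\<Sum>u\<in>?U. card (A u))"
      using sum_bounded_below[of ?U 3 "\<lambda>u. card (A u)"] by simp
    then show False using sum_split cardU cT h by linarith
  qed
  then have cU: "card ?U = h" using cardU by simp
  have "card ({..<Suc h} - r ` T) = 1"
    using card_Diff_subset[OF _ r_less] card_image[OF r_inj] \<open>card T = h\<close> TV by simp
  then obtain f\<^sub>0 where f0: "{..<Suc h} - r ` T = {f\<^sub>0}" by (auto simp: card_1_singleton_iff)
  \<comment> \<open>The total is now attained with equality, so the vertices outside T are centres exactly twice,
    one of the two forests being the exceptional one.\<close>
  have "?U \<subseteq> C f\<^sub>0"
  proof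
    fix u assume u: "u \<in> ?U"
    have "(\<Sum>w\<in>?U. card (A w)) = card (A u) + (\<Sum>w\<in>?U - {u}. card (A w))"
      using fin u by (meson finite_Diff sum.remove)
    moreover have "card (?U - {u}) * 2 \<le> (\<Sum>w\<in>?U - {u}. card (A w))"
      using sum_bounded_below[of "?U - {u}" 2 "\<lambda>u. card (A u)"] two by simp
    moreover have "card (?U - {u}) = h - 1" using u cU fin by simp
    ultimately have "card (A u) \<le> 2" using sum_split \<open>card T = h\<close> h by linarith
    then have "card (A u) = 2" using two[OF u] by simp
    then obtain f where "f \<in> A u" "f \<notin> r ` T" using rT_miss[OF u] by auto
    then show "u \<in> C f\<^sub>0" using f0 unfolding A_def by auto
  qed
  moreover have f0_less: "f\<^sub>0 < Suc h" using f0 by auto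
  ultimately have "h \<le> card (C f\<^sub>0)"
    using card_mono[of "C f\<^sub>0" ?U] CV[OF f0_less] fin cU by (simp add: finite_subset)
  then show ?thesis using f0_less by auto
qed

section \<open>A star cover with four centres\<close>

text \<open>
  The vertices \<open>2i\<close> and \<open>2i + 1\<close> stand for the edges \<open>{i, i + 1}\<close> and
  \<open>{i, i + 2}\<close> of the square of a path, whose nodes are the forests; a vertex is a centre in
  its two end nodes.
\<close>
definition left_end :: "nat \<Rightarrow> nat" where "left_end u = u div 2"
definition right_end :: "nat \<Rightarrow> nat" where "right_end u = u div 2 + 1 + u mod 2"

definition strip_centres :: "nat \<Rightarrow> nat \<Rightarrow> nat set" where
  "strip_centres n x = {u. u < n \<and> (x = left_end u \<or> x = right_end u)}"

text \<open>
  At a node outside its own interval, a vertex chooses an edge pointing back towards itself, so that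
  the pair of edges with extreme ends \<open>y < x\<close> is covered at \<open>y\<close> or at \<open>x\<close>. If
  \<open>x \<ge> y + 3\<close>, there are two edges with left end \<open>y\<close> and two with right end \<open>x\<close>:
  at \<open>x\<close> the former choose the edge of their own kind (short or long) and at \<open>y\<close> the
  latter choose the edge of the other kind, which covers all four pairs. The exceptions at distance
  two deal with the three pairs of edges in a triangle \<open>{y, y + 1, y + 2}\<close>, where each edge
  chooses another one at the node opposite to it. Among the
  vertices that are not centres, the last case concerns only a long edge at its middle node.
\<close>
definition strip_choice :: "nat \<Rightarrow> nat \<Rightarrow> nat" where
  "strip_choice x u =
    (if x < left_end u then (if even u \<and> x + 1 \<noteq> left_end u then 2 * x + 1 else 2 * x)
     else if right_end u < x then (if even u \<and> x \<noteq> left_end u + 2 then 2 * (x - 1) else 2 * (x - 2) + 1)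
     else 2 * x)"

lemma card_strip_centres: "card (strip_centres n x) \<le> 4"
proof -
  have "strip_centres n x \<subseteq> {2 * x, 2 * x + 1, 2 * (x - 1), 2 * (x - 2) + 1}"
  proof
    fix u assume "u \<in> strip_centres n x"
    then show "u \<in> {2 * x, 2 * x + 1, 2 * (x - 1), 2 * (x - 2) + 1}"
      unfolding strip_centres_def left_end_def right_end_def
      by (cases "even u") (auto elim!: evenE oddE)
  qed
  then have "card (strip_centres n x) \<le> card {2 * x, 2 * x + 1, 2 * (x - 1), 2 * (x - 2) + 1}"
    by (intro card_mono) auto
  also have "\<dots> \<le> 4" by (simp add: card_insert_if)
  finally show ?thesis .
qed

text \<open>
  For \<open>u < v\<close> the left end of the two edges is that of \<open>u\<close> and the right end that of
  \<open>v\<close>. The first three cases below are the pairs inside a triangle. An odd \<open>n\<close> is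
  possible, since the path on the \<open>h + 2\<close> nodes \<open>0, \<dots>, h + 1\<close> has a square with
  \<open>2h + 1\<close> edges.
\<close>
lemma strip_star_cover:
  assumes "n \<le> 2 * h + 1"
  shows "star_cover {..<n} (h + 2) (strip_centres n) strip_choice"
proof -
  have main: "\<exists>x<h + 2. joins (strip_centres n x) (strip_choice x) u v"
    if uv: "u < v" "v < n" for u v
  proof -
    obtain i b where u: "u = 2 * i + b" "b < 2" by (metis mod_less_divisor mult_div_mod_eq pos2)
    obtain j c where v: "v = 2 * j + c" "c < 2" by (metis mod_less_divisor mult_div_mod_eq pos2)
    have b: "b = 0 \<or> b = 1" and c: "c = 0 \<or> c = 1" using u v by auto
    let ?y = "left_end u" and ?x = "right_end v"
    have x: "?x < h + 2" "?y < h + 2" "i + 1 < h + 2" using uv assms b c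
      unfolding left_end_def right_end_def u v by auto
    note defs = joins_def strip_centres_def strip_choice_def left_end_def right_end_def
    consider "i = j" "b = 0" "c = 1" | "j = i + 1" "b = 0" "c = 0" | "j = i + 1" "b = 1" "c = 0"
      | "?x \<ge> ?y + 3" "b = c" | "?x \<ge> ?y + 3" "b \<noteq> c"
      using uv b c unfolding left_end_def right_end_def u v by force
    then show ?thesis
    proof cases
      case 1 then have "joins (strip_centres n (i + 2)) (strip_choice (i + 2)) u v"
        using uv unfolding defs u v by auto
      moreover have "i + 2 < h + 2" using 1 x unfolding v right_end_def by simp
      ultimately show ?thesis by blast
    next
      case 2 then have "joins (strip_centres n i) (strip_choice i) u v"
        using uv unfolding defs u v by auto
      then show ?thesis using x(3) by (intro exI[of _ i]) simp
    next
      case 3 then have "joins (strip_centres n (i + 1)) (strip_choice (i + 1)) u v"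
        using uv unfolding defs u v by auto
      then show ?thesis using x by blast
    next
      case 4 then have "joins (strip_centres n ?x) (strip_choice ?x) u v"
        using uv b c unfolding defs u v by auto
      then show ?thesis using x by blast
    next
      case 5 then have "joins (strip_centres n ?y) (strip_choice ?y) u v"
        using uv b c unfolding defs u v by auto
      then show ?thesis using x by blast
    qed
  qed
  show ?thesis unfolding star_cover_def
  proof (intro conjI ballI allI impI)
    show "strip_centres n f \<subseteq> {..<n}" for f unfolding strip_centres_def by auto
    fix u v assume "u \<in> {..<n}" "v \<in> {..<n}" "u \<noteq> v"
    then show "\<exists>f<h + 2. joins (strip_centres n f) (strip_choice f) u v"
      using main[of u v] main[of v u] joins_sym by (metis lessThan_iff nat_neq_iff)
  qed
qed

section \<open>Star forests given by their centres\<close>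

text \<open>
  Centres without leaves are kept as isolated vertices, that is, as stars \<open>K\<^bsub>1,0\<^esub>\<close>. The
  components then correspond to the centres.
\<close>
definition star_graph :: "'a set \<Rightarrow> 'a set \<Rightarrow> ('a \<Rightarrow> 'a) \<Rightarrow> 'a pair_pre_digraph" where
  "star_graph C L p = \<lparr>pverts = C \<union> L, parcs = (\<Union>u\<in>L. {(u, p u), (p u, u)})\<rparr>"

locale centred_stars =
  fixes C L :: "'a set" and p :: "'a \<Rightarrow> 'a"
  assumes finite_C: "finite C" and finite_L: "finite L"
    and disjoint: "C \<inter> L = {}" and centre: "u \<in> L \<Longrightarrow> p u \<in> C"
begin

lemma arc_iff: "(u, v) \<in> parcs (star_graph C L p) \<longleftrightarrow> (u \<in> L \<and> v = p u) \<or> (v \<in> L \<and> u = p v)"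
  unfolding star_graph_def by auto

lemma pverts_star_graph: "pverts (star_graph C L p) = C \<union> L"
  unfolding star_graph_def by simp

lemma centre_neq: "u \<in> L \<Longrightarrow> p u \<noteq> u"
  using centre disjoint by (metis disjoint_iff)

sublocale S: pair_graph "star_graph C L p"
proof
  show "finite (parcs (star_graph C L p))" unfolding star_graph_def using finite_L by simp
  show "fst e \<noteq> snd e" if "e \<in> parcs (star_graph C L p)" for e
    using that centre_neq arc_iff[of "fst e" "snd e"] by (metis prod.collapse)
qed (use finite_C finite_L centre in
      \<open>auto simp: pverts_star_graph arc_iff symmetric_def intro!: symI\<close>)

lemma graph_star_graph: "graph (with_proj (star_graph C L p))"
  by unfold_locales

text \<open>
  Of two consecutive inner vertices of a walk one is a leaf, and the walk enters and leaves it through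
  its only neighbour. So a walk with three arcs has a vertex that recurs two steps later; with three
  or more arcs this is not the closing of the cycle.
\<close>
lemma no_long_cycle:
  assumes "pre_digraph.cycle (with_proj (star_graph C L p)) q"
  shows "length q < 3"
proof (rule ccontr)
  assume long: "\<not> length q < 3"
  then obtain e\<^sub>1 e\<^sub>2 e\<^sub>3 q' where q: "q = e\<^sub>1 # e\<^sub>2 # e\<^sub>3 # q'"
    by (metis One_nat_def length_Cons less_Suc_eq list.exhaust list.size(3) numeral_3_eq_3 zero_less_Suc)
  obtain u where walk: "S.awalk u q u" and dist: "distinct (tl (pawalk_verts u q))"
    using assms unfolding S.cycle_def by auto
  have "S.cas u q u" using walk unfolding S.awalk_def by simp
  then have heads: "tl (pawalk_verts u q) = map snd q"
    using S.awalk_verts_conv'[of u q u] q by simp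
  have chain: "fst e\<^sub>1 = u" "fst e\<^sub>2 = snd e\<^sub>1" "fst e\<^sub>3 = snd e\<^sub>2"
    and arcs: "e\<^sub>1 \<in> parcs (star_graph C L p)" "e\<^sub>2 \<in> parcs (star_graph C L p)" "e\<^sub>3 \<in> parcs (star_graph C L p)"
    using walk unfolding q S.awalk_simps by auto
  have "last (pawalk_verts u q) = u" using \<open>S.cas u q u\<close> by (rule S.awlast_if_cas)
  then have "last (tl (pawalk_verts u q)) = u" using heads q by (simp add: last_tl)
  then have "last (map snd q) = u" using heads by simp
  then have u_in: "u \<in> set (map snd (e\<^sub>3 # q'))"
    unfolding q using last_in_set[of "map snd (e\<^sub>3 # q')"] by simp
  have "distinct (map snd q)" using dist heads by simp
  then have "snd e\<^sub>2 \<noteq> u" "snd e\<^sub>3 \<noteq> snd e\<^sub>1" using u_in unfolding q by auto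
  moreover have "(u, snd e\<^sub>1) \<in> parcs (star_graph C L p)" "(snd e\<^sub>1, snd e\<^sub>2) \<in> parcs (star_graph C L p)"
    "(snd e\<^sub>2, snd e\<^sub>3) \<in> parcs (star_graph C L p)"
    using arcs chain by (metis prod.collapse)+
  ultimately show False
    using disjoint centre unfolding arc_iff by (metis disjoint_iff)
qed

text \<open>The root is constant along arcs and therefore identifies the component.\<close>
definition root :: "'a \<Rightarrow> 'a" where "root v = (if v \<in> C then v else p v)"

lemma root_reachable:
  assumes "v \<in> C \<union> L"
  shows "v \<rightarrow>\<^sup>*\<^bsub>with_proj (star_graph C L p)\<^esub> root v"
proof (cases "v \<in> C")
  case True
  then show ?thesis using S.reachable_refl[of v] by (simp add: root_def pverts_star_graph)
next
  case False
  then have "(v, root v) \<in> parcs (star_graph C L p)" using assms unfolding root_def arc_iff by auto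
  then show ?thesis by (intro S.reachable_adjI) simp
qed

lemma reachable_root_eq:
  assumes "u \<rightarrow>\<^sup>*\<^bsub>with_proj (star_graph C L p)\<^esub> v"
  shows "root u = root v"
  using assms
proof (induct rule: S.reachable_induct)
  case (step x y)
  then have "(x, y) \<in> parcs (star_graph C L p)" by simp
  then show ?case using step(3) disjoint centre unfolding arc_iff root_def by (metis disjoint_iff)
qed simp

lemma reachable_iff_root_eq:
  assumes "u \<in> C \<union> L" "v \<in> C \<union> L"
  shows "u \<rightarrow>\<^sup>*\<^bsub>with_proj (star_graph C L p)\<^esub> v \<longleftrightarrow> root u = root v"
  using reachable_root_eq root_reachable assms S.reachable_trans S.symmetric_reachable' by metis

lemma scc_of_eq:
  assumes "v \<in> C \<union> L"
  shows "S.scc_of v = {w \<in> C \<union> L. root w = root v}"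
proof (intro set_eqI iffI)
  fix w assume "w \<in> S.scc_of v"
  then have reach: "v \<rightarrow>\<^sup>*\<^bsub>with_proj (star_graph C L p)\<^esub> w" unfolding S.scc_of_def by simp
  then have "w \<in> C \<union> L" using S.reachable_in_verts(2)[OF reach] pverts_star_graph by simp
  then show "w \<in> {w \<in> C \<union> L. root w = root v}" using reachable_root_eq[OF reach] by simp
next
  fix w assume "w \<in> {w \<in> C \<union> L. root w = root v}"
  then show "w \<in> S.scc_of v"
    using assms unfolding S.scc_of_def by (simp add: reachable_iff_root_eq)
qed

lemma sccs_verts_eq: "S.sccs_verts = (\<lambda>c. insert c {u \<in> L. p u = c}) ` C"
proof -
  have 1: "S.scc_of v = insert (root v) {u \<in> L. p u = root v}" if "v \<in> C \<union> L" for v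
    unfolding scc_of_eq[OF that] using that disjoint centre by (auto simp: root_def)
  have "S.sccs_verts = S.scc_of ` (C \<union> L)"
    using S.sccs_verts_conv_scc_of pverts_star_graph by simp
  also have "\<dots> = (\<lambda>c. insert c {u \<in> L. p u = c}) ` root ` (C \<union> L)"
    unfolding image_image using 1 by (intro image_cong) auto
  also have "root ` (C \<union> L) = C"
    using centre disjoint unfolding root_def by force
  finally show ?thesis .
qed

lemma star_scc:
  assumes "H \<in> S.sccs"
  shows "star H"
proof -
  have ind: "induced_subgraph H (with_proj (star_graph C L p))" using assms by (rule S.in_sccs_imp_induced)
  have "verts H \<in> S.sccs_verts" using assms S.sccs_verts_conv by blast
  then obtain c where c: "c \<in> C" and vH: "verts H = insert c {u \<in> L. p u = c}"
    unfolding sccs_verts_eq by auto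
  have gH: "graph H" 
    using digraph.graphI[OF S.digraphI_induced[OF ind] induced_graph_imp_symmetric[OF _ ind]] S.sym_arcs by simp
  have "tail H = fst" "head H = snd" using ind by (auto simp: induced_subgraph_def subgraph_def compatible_def)
  moreover have "arcs H = {e \<in> parcs (star_graph C L p). fst e \<in> verts H \<and> snd e \<in> verts H}"
    using ind calculation by (auto simp: induced_subgraph_def)
  ultimately have ends: "arcs_ends H = {e \<in> parcs (star_graph C L p). fst e \<in> verts H \<and> snd e \<in> verts H}"
    by (simp add: arcs_ends_conv)
  let ?L = "{u \<in> L. p u = c}"
  have "arcs_ends H = {c} \<times> ?L \<union> ?L \<times> {c}"
    unfolding ends vH using c disjoint centre by (auto simp: arc_iff)
  moreover have "{c} \<inter> ?L = {}" using c disjoint by auto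
  ultimately show ?thesis
    unfolding star_def complete_bipartite_digraph_def using gH vH
    by (intro exI[of _ "card ?L"] conjI exI[of _ "{c}"] exI[of _ ?L]) simp_all
qed

lemma star_forest_star_graph:
  assumes "card C \<le> k"
  shows "star_forest k (with_proj (star_graph C L p))"
proof -
  have "card S.sccs \<le> card C"
    unfolding S.card_sccs_verts[symmetric] sccs_verts_eq using finite_C by (rule card_image_le)
  then show ?thesis
    unfolding star_forest_def undirected_forest_def
    using graph_star_graph no_long_cycle star_scc assms by force
qed

end

section \<open>Decompositions and star covers\<close>

lemma with_proj_complete_graph:
  "verts (complete_graph n) = {..<n}" "tail (complete_graph n) = fst" "head (complete_graph n) = snd"
  "arcs (complete_graph n) = {(u, v). u < n \<and> v < n \<and> u \<noteq> v}"
  unfolding complete_graph_def by simp_all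

lemma graph_complete_graph: "graph (complete_graph n)"
  using complete_digraph_complete_graph unfolding complete_digraph_def by blast

text \<open>
  Every edge is put into the first forest that covers it, so \<open>L f\<close> below consists of the leaves
  whose edge has not been covered before.
\<close>
lemma star_cover_imp_decomposition:
  assumes cov: "star_cover {..<n} m C p" and card: "\<And>f. f < m \<Longrightarrow> card (C f) \<le> k"
  shows "\<exists>H. decomposition (complete_graph n) {..<m} H \<and> (\<forall>f<m. star_forest k (H f))"
proof -
  define first where "first u v = (LEAST f. joins (C f) (p f) u v)" for u v
  have first_sym: "first u v = first v u" for u v
    unfolding first_def using joins_sym[of "C _" "p _" u v] by metis
  have first: "first u v < m" "joins (C (first u v)) (p (first u v)) u v"
    if uv: "u < n" "v < n" "u \<noteq> v" for u v
  proof -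
    obtain f where f: "f < m" "joins (C f) (p f) u v"
      using cov uv unfolding star_cover_def by blast
    from f(2) show "joins (C (first u v)) (p (first u v)) u v" unfolding first_def
      by (rule LeastI[of "\<lambda>f. joins (C f) (p f) u v"])
    show "first u v < m" unfolding first_def
      using Least_le[of "\<lambda>f. joins (C f) (p f) u v", OF f(2)] f(1) by simp
  qed
  have CV: "f < m \<Longrightarrow> C f \<subseteq> {..<n}" for f using cov unfolding star_cover_def by blast
  define L where "L f = {u. u < n \<and> u \<notin> C f \<and> p f u \<in> C f \<and> first u (p f u) = f}" for f
  define H where "H f = with_proj (star_graph (C f) (L f) (p f))" for f
  have stars: "centred_stars (C f) (L f) (p f)" if "f < m" for f
    using CV[OF that] by unfold_locales (auto simp: L_def finite_subset)
  have arcs_H: "arcs (H f) = {(u, v). u < n \<and> v < n \<and> u \<noteq> v \<and> first u v = f}" if f: "f < m" for f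
  proof -
    have "(u, v) \<in> arcs (H f) \<longleftrightarrow> u < n \<and> v < n \<and> u \<noteq> v \<and> first u v = f" for u v
    proof -
      have "(u, v) \<in> arcs (H f) \<longleftrightarrow> u \<in> L f \<and> v = p f u \<or> v \<in> L f \<and> u = p f v"
        unfolding H_def using centred_stars.arc_iff[OF stars[OF f]] by simp
      also have "\<dots> \<longleftrightarrow> u < n \<and> v < n \<and> joins (C f) (p f) u v \<and> first u v = f"
        unfolding L_def joins_def using CV[OF f] first_sym by auto
      also have "\<dots> \<longleftrightarrow> u < n \<and> v < n \<and> u \<noteq> v \<and> first u v = f"
        using first(2)[of u v] unfolding joins_def by auto
      finally show ?thesis .
    qed
    then show ?thesis by auto
  qed
  have gH: "graph (H f)" if "f < m" for f
    unfolding H_def by (rule centred_stars.graph_star_graph[OF stars[OF that]])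
  have "subgraph (H f) (complete_graph n)" if f: "f < m" for f
  proof (rule subgraphI)
    show "verts (H f) \<subseteq> verts (complete_graph n)"
      using CV[OF f] by (auto simp: H_def star_graph_def with_proj_complete_graph L_def)
    show "arcs (H f) \<subseteq> arcs (complete_graph n)"
      using arcs_H[OF f] by (auto simp: with_proj_complete_graph)
    show "compatible (complete_graph n) (H f)" unfolding complete_graph_def H_def by (rule compatibleI_with_proj)
    show "wf_digraph (H f)" "wf_digraph (complete_graph n)"
      using gH[OF f] graph_complete_graph by (simp_all add: graph_def digraph_def fin_digraph_def)
  qed
  moreover have "disjoint_family_on (\<lambda>f. arcs (H f)) {..<m}"
    unfolding disjoint_family_on_def using arcs_H by auto
  moreover have "(\<Union>f\<in>{..<m}. arcs (H f)) = arcs (complete_graph n)"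
    using arcs_H first(1) by (auto simp: with_proj_complete_graph)
  moreover have "star_forest k (H f)" if f: "f < m" for f
    unfolding H_def by (rule centred_stars.star_forest_star_graph[OF stars[OF f] card[OF f]])
  ultimately show ?thesis unfolding decomposition_def using gH by blast
qed

text \<open>
  The centre chosen by a vertex is the centre of its component. A star with one edge has two
  possible centres, of which an arbitrary one is fixed; a leaf is not a centre because components are
  disjoint.
\<close>
lemma star_forest_centres:
  assumes "star_forest k G"
  shows "\<exists>C p. C \<subseteq> verts G \<and> card C \<le> k \<and> (\<forall>(u, v)\<in>arcs_ends G. joins C p u v)"
proof -
  interpret graph G using assms unfolding star_forest_def undirected_forest_def by blast
  have "\<exists>c V. verts S = insert c V \<and> c \<notin> V \<and> arcs_ends S = {c} \<times> V \<union> V \<times> {c}" if "S \<in> sccs" for S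
  proof -
    have "star S" using that assms unfolding star_forest_def by blast
    then show ?thesis unfolding star_def complete_bipartite_digraph_def
      by (auto simp: card_1_singleton_iff) blast+
  qed
  then obtain ctr W where ctr: "verts S = insert (ctr S) (W S)" "ctr S \<notin> W S"
      "arcs_ends S = {ctr S} \<times> W S \<union> W S \<times> {ctr S}" if "S \<in> sccs" for S
    by metis
  define C where "C = ctr ` sccs"
  define p where "p u = ctr (THE S. S \<in> sccs \<and> u \<in> verts S)" for u
  have fin: "finite sccs"
    using finite_sccs_verts unfolding sccs_verts_conv by (rule finite_imageD) (rule inj_on_verts_sccs)
  have p_eq: "p u = ctr S" if "S \<in> sccs" "u \<in> verts S" for u S
  proof -
    have "(THE S. S \<in> sccs \<and> u \<in> verts S) = S" using that scc_disj by (intro the_equality) auto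
    then show ?thesis unfolding p_def by simp
  qed
  have "card C \<le> k"
    using card_image_le[OF fin, of ctr] assms unfolding C_def star_forest_def by simp
  moreover have "C \<subseteq> verts G"
  proof
    fix c assume "c \<in> C"
    then obtain S where "S \<in> sccs" "c = ctr S" unfolding C_def by auto
    then have "c \<in> verts S" "verts S \<subseteq> verts G"
      using ctr(1)[of S] in_sccs_imp_induced[of S] by (auto simp: induced_subgraph_def subgraph_def)
    then show "c \<in> verts G" by auto
  qed
  moreover have "joins C p u v" if uv: "(u, v) \<in> arcs_ends G" for u v
  proof -
    have vu: "(v, u) \<in> arcs_ends G" using uv by (rule graph_symmetric)
    have mem: "u \<in> verts G" using uv adj_in_verts by blast
    have "scc_of u \<in> sccs_verts" by (rule scc_of_in_sccs_verts[OF mem])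
    then obtain S where S: "S \<in> sccs" "verts S = scc_of u" unfolding sccs_verts_conv by auto
    have inS: "u \<in> verts S" "v \<in> verts S"
      unfolding S(2) scc_of_def using mem uv vu by auto
    have "(u, v) \<in> arcs_ends S"
      using uv inS in_sccs_imp_induced[OF S(1)]
      by (auto simp: arcs_ends_conv induced_subgraph_def subgraph_def compatible_def)
    then have or: "(u = ctr S \<and> v \<in> W S) \<or> (v = ctr S \<and> u \<in> W S)" unfolding ctr(3)[OF S(1)] by auto
    have leaf: "w \<notin> C" if "w \<in> W S" for w
    proof
      assume "w \<in> C"
      then obtain S' where "S' \<in> sccs" "w = ctr S'" unfolding C_def by auto
      then show False using ctr[OF S(1)] ctr(1)[of S'] that scc_disj[OF S(1), of S'] by auto
    qed
    show ?thesis
      using or leaf p_eq[OF S(1)] inS S(1) unfolding joins_def C_def by auto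
  qed
  ultimately show ?thesis by blast
qed

lemma decomposition_imp_star_cover:
  assumes dec: "decomposition (complete_graph n) {..<m} H" and forest: "\<And>f. f < m \<Longrightarrow> star_forest k (H f)"
  shows "\<exists>C p. star_cover {..<n} m C p \<and> (\<forall>f<m. card (C f) \<le> k)"
proof -
  have "\<forall>f. \<exists>C p. f < m \<longrightarrow> C \<subseteq> verts (H f) \<and> card C \<le> k \<and> (\<forall>(u, v)\<in>arcs_ends (H f). joins C p u v)"
    using star_forest_centres[OF forest] by blast
  then obtain C p where "\<forall>f<m. C f \<subseteq> verts (H f) \<and> card (C f) \<le> k \<and>
      (\<forall>(u, v)\<in>arcs_ends (H f). joins (C f) (p f) u v)"
    by metis
  then have Cp: "C f \<subseteq> verts (H f)" "card (C f) \<le> k"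
      "(u, v) \<in> arcs_ends (H f) \<Longrightarrow> joins (C f) (p f) u v" if "f < m" for f u v
    using that by auto
  have sub: "subgraph (H f) (complete_graph n)" if "f < m" for f
    using dec that unfolding decomposition_def by blast
  have "\<exists>f<m. joins (C f) (p f) u v" if "u < n" "v < n" "u \<noteq> v" for u v
  proof -
    have "(u, v) \<in> arcs (complete_graph n)" using that by (simp add: with_proj_complete_graph)
    then obtain f where f: "f < m" "(u, v) \<in> arcs (H f)" using dec unfolding decomposition_def by blast
    moreover have "tail (H f) = fst" "head (H f) = snd"
      using sub[OF f(1)] by (auto simp: subgraph_def compatible_def with_proj_complete_graph)
    ultimately have "(u, v) \<in> arcs_ends (H f)" by (force simp: arcs_ends_conv)
    then show ?thesis using Cp(3) f(1) by blast
  qed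
  moreover have "C f \<subseteq> {..<n}" if "f < m" for f
    using Cp(1)[OF that] sub[OF that] by (auto simp: subgraph_def with_proj_complete_graph)
  ultimately show ?thesis using Cp(2) unfolding star_cover_def by blast
qed

section \<open>The minimum number of star forests\<close>

lemma F_eq_of_even:
  assumes k: "4 \<le> k" and n: "2 * k < n" "even n"
  shows "F k n = n div 2 + 2"
proof -
  obtain h where h: "n = 2 * h" using n(2) by (auto elim: evenE)
  have "\<exists>H. decomposition (complete_graph n) {..<h + 2} H \<and> (\<forall>f<h + 2. star_forest k (H f))"
  proof (rule star_cover_imp_decomposition)
    show "star_cover {..<n} (h + 2) (strip_centres n) strip_choice"
      by (rule strip_star_cover) (simp add: h)
    show "card (strip_centres n f) \<le> k" for f using card_strip_centres[of n f] k by simp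
  qed
  moreover have "h + 2 \<le> m"
    if dec: "\<exists>H. decomposition (complete_graph n) {..<m} H \<and> (\<forall>f<m. star_forest k (H f))" for m
  proof (rule ccontr)
    assume "\<not> h + 2 \<le> m"
    then have m: "m \<le> Suc h" by simp
    obtain C p where cov: "star_cover {..<n} m C p" and card: "\<forall>f<m. card (C f) \<le> k"
      using decomposition_imp_star_cover dec by blast
    \<comment> \<open>Padding with forests without centres turns m into exactly \<open>h + 1\<close>.\<close>
    define C' where "C' f = (if f < m then C f else {})" for f
    have "star_cover {..<n} (Suc h) C' p"
      unfolding star_cover_def
    proof (intro conjI ballI allI impI)
      show "C' f \<subseteq> {..<n}" for f using cov unfolding star_cover_def C'_def by auto
      fix u v assume "u \<in> {..<n}" "v \<in> {..<n}" "u \<noteq> v"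
      then obtain f where "f < m" "joins (C f) (p f) u v" using cov unfolding star_cover_def by blast
      then show "\<exists>f<Suc h. joins (C' f) (p f) u v" using m unfolding C'_def by (intro exI[of _ f]) simp
    qed
    then obtain f where "h \<le> card (C' f)"
      using star_cover_many_centres[of "{..<n}" h C' p] h n(1) k by auto
    then show False using card h n(1) k unfolding C'_def by (cases "f < m") auto
  qed
  ultimately have "F k n = h + 2" unfolding F_def by (rule Least_equality)
  then show ?thesis using h by simp
qed

theorem theorem1p5:
  fixes k n :: nat
  assumes "k \<ge> 4" and "n > 2 * k" and "[n = 4] (mod 12)"
  shows "real (F k n) = real n / 2 + 2"
proof -
  have "[n = 4] (mod 2)" using assms(3) by (rule cong_dvd_modulus_nat) simp
  then have "even n" by (simp add: cong_def even_iff_mod_2_eq_zero)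
  then obtain h where h: "n = 2 * h" ..
  have "F k n = n div 2 + 2" by (rule F_eq_of_even[OF assms(1,2) \<open>even n\<close>])
  then show ?thesis unfolding h by simp
qed

end
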